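(* Let $(P, \ge)$ be a finite poset. There exists a countable deterministic two-dimensional subshift of finite type $X$ with the bounded signal property such that $(P,\ge)$ can be order-embedded in the subpattern poset $SP(X)$.
   Context: Let $S$ be a finite set and give $S^{\mathbb{Z}^d}$ the product topology. Shifts are $\sigma^{\vec n}(x)_{\vec m} = x_{\vec n+\vec m}$. A subshift is a closed shift-invariant subset of $S^{\mathbb{Z}^d}$; it is of finite type (an SFT) if it is the set of configurations avoiding a finite set of forbidden finite patterns. A block map is a continuous shift-commuting map between subshifts; two subshifts are conjugate if there is a bijective block map between them. Subpattern poset. For $x \in S^{\mathbb{Z}^2}$ let $\mathcal{B}(x)$ be the set of finite patterns occurring in $x$ (up to translation). Write $x \le y$ if $\mathcal{B}(x) \subset \mathcal{B}(y)$. $SP(X)$ is the poset obtained from the preorder $\le$ on $X$ by identifying $x,y$ with $x \le y \le x$. An order-embedding of posets is an injective map $\phi$ with $p \le q$ if and only if $\phi(p) \le \phi(q)$. Determinism. Let $H = \{(a,b) \in \mathbb{Z}^2 : b \ge 1\}$. A subshift $X \subset S^{\mathbb{Z}^2}$ is southward (downward) deterministic if every configuration of the half-plane $H$ extends to at most one element of $X$ (i.e. $y,y' \in X$ with $y|_H = y'|_H$ implies $y=y'$). For $A \in SL_2(\mathbb{Z})$ put $A(x)_{\vec n} = x_{A^{-1}\vec n}$ and $A(X) = \{A(x) : x \in X\}$. For $\vec d \in \mathbb{Z}^2$ with coprime coordinates, $X$ is deterministic in direction $\vec d$ if $A(X)$ is southward deterministic, where $A \in SL_2(\mathbb{Z})$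 maps the counterclockwise rotation of $\vec d$ by $\pi/2$ to $(1,0)$. "Deterministic" with no direction means deterministic in at least one direction. Bounded signal property. The projective subdynamics of $X$ is the set of its horizontal rows, $PS(X) = \{ (x_{(j,0)})_{j \in \mathbb{Z}} : x \in X\}$. $X$ has the bounded signal property if some $\tilde X$ conjugate to $X$ satisfies $PS(\tilde X) \subset Y$ for some countable one-dimensional SFT $Y$. (When an SFT $X$ is asserted to exist with this property, it is meant that $PS(X)$ itself is contained in a countable one-dimensional SFT.) *)

theory Defs
  imports "HOL-Analysis.Analysis"
begin

text \<open>
  Configurations over an additive group are functions; the group is \<^typ>\<open>int\<close> in dimension one
  and \<^typ>\<open>int^2\<close> in dimension two. The finite alphabet is a set \<open>S\<close>, not a type, so that
  statements can quantify over it.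
\<close>

definition full_shift :: "'a set \<Rightarrow> ('g \<Rightarrow> 'a) topology" where
  "full_shift S = product_topology (\<lambda>_. discrete_topology S) UNIV"

definition shift :: "'g::ab_group_add \<Rightarrow> ('g \<Rightarrow> 'a) \<Rightarrow> ('g \<Rightarrow> 'a)" where
  "shift n x = (\<lambda>m. x (n + m))"

definition subshift :: "'a set \<Rightarrow> ('g::ab_group_add \<Rightarrow> 'a) set \<Rightarrow> bool" where
  "subshift S X \<longleftrightarrow> finite S \<and> closedin (full_shift S) X \<and> (\<forall>n. shift n ` X \<subseteq> X)"

text \<open>A pattern is a partial map with finite domain; it may occur at any position.\<close>

definition occurs :: "('g::ab_group_add \<rightharpoonup> 'a) \<Rightarrow> ('g \<Rightarrow> 'a) \<Rightarrow> bool" where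
  "occurs p x \<longleftrightarrow> (\<exists>n. \<forall>m\<in>dom p. p m = Some (shift n x m))"

definition sft :: "'a set \<Rightarrow> ('g::ab_group_add \<Rightarrow> 'a) set \<Rightarrow> bool" where
  "sft S X \<longleftrightarrow> subshift S X \<and>
     (\<exists>F. finite F \<and> (\<forall>p\<in>F. finite (dom p) \<and> ran p \<subseteq> S) \<and>
          X = {x. range x \<subseteq> S \<and> (\<forall>p\<in>F. \<not> occurs p x)})"

definition patterns :: "('g::ab_group_add \<Rightarrow> 'a) \<Rightarrow> ('g \<rightharpoonup> 'a) set" where
  "patterns x = {p. finite (dom p) \<and> occurs p x}"

definition subpattern :: "('g::ab_group_add \<Rightarrow> 'a) \<Rightarrow> ('g \<Rightarrow> 'a) \<Rightarrow> bool" where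
  "subpattern x y \<longleftrightarrow> patterns x \<subseteq> patterns y"

definition SP :: "('g::ab_group_add \<Rightarrow> 'a) set \<Rightarrow> ('g \<Rightarrow> 'a) set set" where
  "SP X = X // {(x, y). x \<in> X \<and> y \<in> X \<and> subpattern x y \<and> subpattern y x}"

definition SP_le :: "('g::ab_group_add \<Rightarrow> 'a) set \<Rightarrow> ('g \<Rightarrow> 'a) set rel" where
  "SP_le X = {(C, D). C \<in> SP X \<and> D \<in> SP X \<and> (\<exists>x\<in>C. \<exists>y\<in>D. subpattern x y)}"

text \<open>A poset is a carrier with an order relation; \<open>(p, q) \<in> r\<close> means that \<open>p\<close> is below \<open>q\<close>.\<close>

definition order_embedding :: "'p set \<Rightarrow> 'p rel \<Rightarrow> 'q set \<Rightarrow> 'q rel \<Rightarrow> ('p \<Rightarrow> 'q) \<Rightarrow> bool" where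
  "order_embedding P r Q s f \<longleftrightarrow> f ` P \<subseteq> Q \<and> inj_on f P \<and>
     (\<forall>p\<in>P. \<forall>q\<in>P. (p, q) \<in> r \<longleftrightarrow> (f p, f q) \<in> s)"

definition upper_half_plane :: "(int^2) set" where
  "upper_half_plane = {v. v $ 2 \<ge> 1}"

definition southward_deterministic :: "(int^2 \<Rightarrow> 'a) set \<Rightarrow> bool" where
  "southward_deterministic X \<longleftrightarrow>
     (\<forall>y\<in>X. \<forall>y'\<in>X. (\<forall>v\<in>upper_half_plane. y v = y' v) \<longrightarrow> y = y')"

definition transform :: "int^2^2 \<Rightarrow> (int^2 \<Rightarrow> 'a) \<Rightarrow> (int^2 \<Rightarrow> 'a)" where
  "transform A x = (\<lambda>n. x (matrix_inv A *v n))"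

text \<open>
  The vector \<open>(- d $ 2, d $ 1)\<close> is the counterclockwise rotation of \<open>d\<close> by a right angle. Two
  admissible matrices \<open>A\<close> differ by a horizontal shear, which preserves the half-plane, so the
  choice of \<open>A\<close> is immaterial.
\<close>

definition deterministic_in_direction :: "int^2 \<Rightarrow> (int^2 \<Rightarrow> 'a) set \<Rightarrow> bool" where
  "deterministic_in_direction d X \<longleftrightarrow> coprime (d $ 1) (d $ 2) \<and>
     (\<exists>A. det A = 1 \<and> A *v vector [- (d $ 2), d $ 1] = vector [1, 0] \<and>
          southward_deterministic (transform A ` X))"

definition deterministic :: "(int^2 \<Rightarrow> 'a) set \<Rightarrow> bool" where
  "deterministic X \<longleftrightarrow> (\<exists>d. deterministic_in_direction d X)"

definition projective_subdynamics :: "(int^2 \<Rightarrow> 'a) set \<Rightarrow> (int \<Rightarrow> 'a) set" where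
  "projective_subdynamics X = (\<lambda>x j. x (vector [j, 0])) ` X"

text \<open>
  This is the property for the given \<open>X\<close> itself. The conjugacy-invariant version, which asks it of
  some subshift conjugate to \<open>X\<close>, is weaker.
\<close>

definition bounded_signal :: "(int^2 \<Rightarrow> 'a) set \<Rightarrow> bool" where
  "bounded_signal X \<longleftrightarrow> (\<exists>T Y. sft T Y \<and> countable Y \<and> projective_subdynamics X \<subseteq> Y)"


lemma subpattern_trans: "subpattern x y \<Longrightarrow> subpattern y z \<Longrightarrow> subpattern x z"
  by (auto simp: subpattern_def)

lemma equiv_SP:
  "equiv X {(x, y). x \<in> X \<and> y \<in> X \<and> subpattern x y \<and> subpattern y x}"
  by (auto intro!: equivI refl_onI symI transI simp: subpattern_def)

lemma SP_le_iff:
  assumes "C \<in> SP X" "D \<in> SP X" "x \<in> C" "y \<in> D"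
  shows "(C, D) \<in> SP_le X \<longleftrightarrow> subpattern x y"
proof
  assume "(C, D) \<in> SP_le X"
  then obtain x' y' where xy: "x' \<in> C" "y' \<in> D" "subpattern x' y'"
    by (auto simp: SP_le_def)
  have "subpattern x x'"
    using quotient_eq_iff[OF equiv_SP assms(1)[unfolded SP_def] assms(1)[unfolded SP_def] assms(3) xy(1)]
    by auto
  moreover have "subpattern y' y"
    using quotient_eq_iff[OF equiv_SP assms(2)[unfolded SP_def] assms(2)[unfolded SP_def] xy(2) assms(4)]
    by auto
  ultimately show "subpattern x y"
    using xy(3) by (blast intro: subpattern_trans)
next
  assume "subpattern x y"
  then show "(C, D) \<in> SP_le X"
    using assms by (auto simp: SP_le_def)
qed

lemma SP_nonempty: "C \<in> SP X \<Longrightarrow> \<exists>x. x \<in> C"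
  unfolding SP_def using in_quotient_imp_non_empty[OF equiv_SP] by blast

lemma partial_order_on_SP: "partial_order_on (SP X) (SP_le X)"
proof -
  have "refl_on (SP X) (SP_le X)"
    by (rule refl_onI) (metis SP_le_iff SP_nonempty order_refl subpattern_def)
  moreover have "trans (SP_le X)"
  proof (rule transI)
    fix C D E assume CD: "(C, D) \<in> SP_le X" and DE: "(D, E) \<in> SP_le X"
    have S: "C \<in> SP X" "D \<in> SP X" "E \<in> SP X"
      using CD DE by (auto simp: SP_le_def)
    obtain x y z where E: "x \<in> C" "y \<in> D" "z \<in> E"
      using S SP_nonempty by meson
    show "(C, E) \<in> SP_le X"
      using CD DE SP_le_iff[OF S(1,2) E(1,2)] SP_le_iff[OF S(2,3) E(2,3)]
        SP_le_iff[OF S(1,3) E(1,3)] subpattern_trans by blast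
  qed
  moreover have "antisym (SP_le X)"
  proof (rule antisymI)
    fix C D assume CD: "(C, D) \<in> SP_le X" and DC: "(D, C) \<in> SP_le X"
    have S: "C \<in> SP X" "D \<in> SP X"
      using CD by (auto simp: SP_le_def)
    obtain x y where E: "x \<in> C" "y \<in> D"
      using S SP_nonempty by meson
    have X: "x \<in> X" "y \<in> X"
      using S E in_quotient_imp_subset[OF equiv_SP] unfolding SP_def by blast+
    have "subpattern x y" "subpattern y x"
      using CD DC SP_le_iff[OF S E] SP_le_iff[OF S(2,1) E(2,1)] by auto
    then show "C = D"
      using X quotient_eq_iff[OF equiv_SP S(1)[unfolded SP_def] S(2)[unfolded SP_def] E]
      by auto
  qed
  ultimately show ?thesis
    by (auto simp: partial_order_on_def preorder_on_def SP_le_def)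
qed

lemma topspace_full_shift: "topspace (full_shift S) = {x. range x \<subseteq> S}"
  by (auto simp: full_shift_def)

lemma subshift_avoiding:
  assumes "finite S" and fin: "\<And>p. p \<in> F \<Longrightarrow> finite (dom p)"
  shows "subshift S {x. range x \<subseteq> S \<and> (\<forall>p\<in>F. \<not> occurs p x)}"
proof -
  have op: "openin (full_shift S) {x. range x \<subseteq> S \<and> occurs p x}" if "p \<in> F" for p
  proof -
    have c: "openin (full_shift S) {x \<in> topspace (full_shift S). x k \<in> {a. a \<in> S \<and> v = Some a}}" for k v
      unfolding full_shift_def
      by (rule openin_continuous_map_preimage[OF continuous_map_product_projection]) auto
    define U where "U = (\<lambda>n m. {x \<in> topspace (full_shift S). x (n + m) \<in> {a. a \<in> S \<and> p m = Some a}})"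
    have "{x. range x \<subseteq> S \<and> occurs p x} = (\<Union>n. (\<Inter>m\<in>dom p. U n m) \<inter> topspace (full_shift S))"
      by (auto simp: U_def topspace_full_shift occurs_def shift_def)
    moreover have "openin (full_shift S) (\<Union>n. (\<Inter>m\<in>dom p. U n m) \<inter> topspace (full_shift S))"
    proof -
      have "openin (full_shift S) (U n m)" for n m
        unfolding U_def by (rule c)
      then have "openin (full_shift S) ((\<Inter>m\<in>dom p. U n m) \<inter> topspace (full_shift S))" for n
        by (intro openin_INT fin[OF that])
      then show ?thesis
        by (intro openin_Union) blast
    qed
    ultimately show ?thesis
      by simp
  qed
  have "{x. range x \<subseteq> S \<and> (\<forall>p\<in>F. \<not> occurs p x)} =
     topspace (full_shift S) - (\<Union>p\<in>F. {x. range x \<subseteq> S \<and> occurs p x})"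
    by (auto simp: topspace_full_shift)
  then have "closedin (full_shift S) {x. range x \<subseteq> S \<and> (\<forall>p\<in>F. \<not> occurs p x)}"
    using op by (auto intro!: openin_Union)
  moreover have "occurs p x" if "occurs p (shift n x)" for p n and x :: "'b \<Rightarrow> 'a"
    using that unfolding occurs_def shift_def by (metis add.assoc)
  ultimately show ?thesis
    using assms(1) by (auto simp: subshift_def) (auto simp: shift_def)
qed

end

theory Submission
  imports Defs
begin

text \<open>
  The configurations are space-time diagrams, time running southwards, of a reversible machine with
  one head whose tape carries a bounded number of walls. Program \<open>p\<close> owns one wall; with the wall at
  distance \<open>N\<close> from the origin, it calls one of the programs strictly below \<open>p\<close> inside the
  space it encloses, then moves the wall one step to the right and turns to the next program. When the
  wall of a program is stopped by the wall of its caller, the program switches to running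
  backwards, which eventually cleans up its space and returns to the caller. Termination needs no
  analysis of this run: a reversible machine in a bounded space that starts in a configuration
  without predecessor inside that space has to leave it.

  The point of \<open>p\<close> is the diagram in which a call of \<open>p\<close> arrives from the right at infinity on an
  otherwise blank tape. Since program \<open>q\<close> calls each smaller \<open>p\<close> in arbitrarily large spaces, the
  point of \<open>p\<close> is a subpattern of the point of \<open>q\<close>; conversely the letter for a call of \<open>p\<close>
  occurs only in points of programs above \<open>p\<close>. Reversibility makes a diagram determined by any
  one of its rows, and the rows are eventually constant, so there are countably many diagrams.
\<close>

section \<open>Cells, time reversal and the rank of a cell\<close>

text \<open>
  A row consists of \<open>Void\<close> cells, \<open>Trail\<close> cells, the head, and then \<open>Blank\<close> cells and walls, from
  left to right; blocks may be missing. The head is \<open>Call c\<close>, walking left to start program \<open>c\<close> at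
  the border of the void, or \<open>Return c\<close>, walking right after a run of \<open>c\<close>. In \<open>Wall p i m\<close>, \<open>p\<close> is
  the owner, \<open>i\<close> the index of the program it is calling, and \<open>m\<close> tells whether \<open>p\<close> is running
  forwards. \<open>Blank c\<close> announces that the next wall is one that is calling \<open>c\<close>.
\<close>
datatype cell = Void | Trail | Blank nat | Call nat | Return nat | Wall nat nat bool

instance cell :: countable
  by countable_datatype

fun is_head :: "cell \<Rightarrow> bool" where
  "is_head (Call c) = True"
| "is_head (Return c) = True"
| "is_head _ = False"

fun flip :: "cell \<Rightarrow> cell" where
  "flip (Call c) = Return c"
| "flip (Return c) = Call c"
| "flip (Wall p i m) = Wall p i (\<not> m)"
| "flip a = a"

lemma flip_flip [simp]: "flip (flip a) = a"
  by (cases a) auto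

lemma is_head_flip [simp]: "is_head (flip a) = is_head a"
  by (cases a) auto

text \<open>The weights interleave blanks and walls: the wall of \<open>p\<close> ranks above every
  announcement of a program smaller than \<open>p\<close> and just below \<open>Blank p\<close>.
  This makes the rank monotone along a row.\<close>

fun rk :: "cell \<Rightarrow> nat" where
  "rk Void = 0"
| "rk Trail = 1"
| "rk (Call c) = 2"
| "rk (Return c) = 2"
| "rk (Blank c) = 3 + 2 * c"
| "rk (Wall p i m) = 2 + 2 * p"

section \<open>The alphabet and the language of rows\<close>

locale machine =
  fixes n :: nat and lt :: "nat \<Rightarrow> nat \<Rightarrow> bool"
  assumes lt_trans: "lt a b \<Longrightarrow> lt b c \<Longrightarrow> lt a c"
    and lt_less: "lt a b \<Longrightarrow> a < b"
begin

text \<open>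
  Index \<open>i\<close> stands for the trivial program \<open>0\<close> unless \<open>i\<close> is below \<open>p\<close>, so that every program can
  cycle through the same indices.
\<close>
definition child :: "nat \<Rightarrow> nat \<Rightarrow> nat" where
  "child p i = (if lt i p then i else 0)"

definition nxt :: "nat \<Rightarrow> nat" where
  "nxt i = (if i = n then 0 else Suc i)"

definition prv :: "nat \<Rightarrow> nat" where
  "prv i = (if i = 0 then n else i - 1)"

lemma nxt_le: "i \<le> n \<Longrightarrow> nxt i \<le> n" and prv_le: "i \<le> n \<Longrightarrow> prv i \<le> n"
  and nxt_prv: "i \<le> n \<Longrightarrow> nxt (prv i) = i" and prv_nxt: "i \<le> n \<Longrightarrow> prv (nxt i) = i"
  by (auto simp: nxt_def prv_def)

lemma child_le: "child p i \<le> i"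
  by (simp add: child_def)

lemma child_0 [simp]: "child p 0 = 0"
  by (simp add: child_def)

lemma child_less: "0 < p \<Longrightarrow> child p i < p"
  by (auto simp: child_def lt_less)

fun letter :: "cell \<Rightarrow> bool" where
  "letter (Blank c) \<longleftrightarrow> c \<le> n"
| "letter (Call c) \<longleftrightarrow> c \<le> n"
| "letter (Return c) \<longleftrightarrow> c \<le> n"
| "letter (Wall p i m) \<longleftrightarrow> 0 < p \<and> p \<le> n \<and> i \<le> n"
| "letter _ \<longleftrightarrow> True"

lemma finite_letters: "finite (Collect letter)"
proof (rule finite_subset)
  show "Collect letter \<subseteq> {Void, Trail} \<union> Blank ` {..n} \<union> Call ` {..n} \<union> Return ` {..n} \<union>
    (\<lambda>(p, i, m). Wall p i m) ` ({..n} \<times> {..n} \<times> UNIV)"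
  proof
    fix a assume "a \<in> Collect letter"
    then show "a \<in> {Void, Trail} \<union> Blank ` {..n} \<union> Call ` {..n} \<union> Return ` {..n} \<union>
      (\<lambda>(p, i, m). Wall p i m) ` ({..n} \<times> {..n} \<times> UNIV)"
      by (cases a) (auto simp: image_iff)
  qed
qed auto

text \<open>An announcement of \<open>c\<close> continues until the wall that is calling
  \<open>c\<close>. Since \<open>adj\<close> demands \<open>fits p\<close> to the right of a wall
  owned by \<open>p\<close>, walls are nested like a call stack.\<close>

fun fits :: "nat \<Rightarrow> cell \<Rightarrow> bool" where
  "fits c (Blank d) \<longleftrightarrow> d = c"
| "fits c (Wall p i m) \<longleftrightarrow> child p i = c"
| "fits c _ \<longleftrightarrow> False"

fun adj :: "cell \<Rightarrow> cell \<Rightarrow> bool" where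
  "adj Void b \<longleftrightarrow> b = Void \<or> b = Trail \<or> is_head b"
| "adj Trail b \<longleftrightarrow> b = Trail \<or> is_head b"
| "adj (Call c) b \<longleftrightarrow> fits c b"
| "adj (Return c) b \<longleftrightarrow> fits c b"
| "adj (Blank c) b \<longleftrightarrow> fits c b"
| "adj (Wall p i m) b \<longleftrightarrow> fits p b"

definition valid :: "(int \<Rightarrow> cell) \<Rightarrow> bool" where
  "valid u \<longleftrightarrow> (\<forall>i. letter (u i) \<and> adj (u i) (u (i + 1)))"

lemma letter_flip [simp]: "letter (flip a) = letter a"
  by (cases a) auto

lemma fits_flip [simp]: "fits c (flip a) = fits c a"
  by (cases a) auto

lemma adj_flip [simp]: "adj (flip a) (flip b) = adj a b"
  by (cases a; cases b) auto

lemma valid_flip: "valid u \<Longrightarrow> valid (flip \<circ> u)"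
  by (simp add: valid_def)

text \<open>A wall calls a program smaller than its owner, so the next cell either repeats or climbs
  in rank. This is the source of the unique head and of the eventually constant rows.\<close>

lemma adj_rk: "letter b \<Longrightarrow> adj a b \<Longrightarrow> a = b \<and> \<not> is_head a \<or> rk a < rk b"
 proof -
  have [simp]: "child p i < p" "Suc (2 * child p i) < 2 * p" if "0 < p" for p i
    using child_less[OF that, of i] by auto
  show "letter b \<Longrightarrow> adj a b \<Longrightarrow> a = b \<and> \<not> is_head a \<or> rk a < rk b"
    by (cases a; cases b) auto
qed

lemma valid_adj: "valid u \<Longrightarrow> adj (u i) (u (i + 1))"
  and valid_letter: "valid u \<Longrightarrow> letter (u i)"
  by (auto simp: valid_def)

lemma valid_mono: "valid u \<Longrightarrow> i \<le> j \<Longrightarrow> rk (u i) \<le> rk (u j)"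
proof -
  assume v: "valid u" and "i \<le> j"
  from this(2) show ?thesis
  proof (induction j rule: int_ge_induct)
    case (step j)
    then show ?case
      using adj_rk[OF valid_letter[OF v, of "j + 1"] valid_adj[OF v, of j]] by auto
  qed simp
qed

lemma valid_head_less:
  assumes "valid u" "is_head (u i)" "i < j"
  shows "rk (u i) < rk (u j)"
proof -
  have "rk (u i) < rk (u (i + 1))"
    using adj_rk[OF valid_letter[OF assms(1), of "i + 1"] valid_adj[OF assms(1), of i]] assms(2)
    by auto
  with valid_mono[OF assms(1), of "i + 1" j] assms(3) show ?thesis
    by simp
qed

lemma is_head_rk: "letter a \<Longrightarrow> is_head a \<longleftrightarrow> rk a = 2"
  by (cases a) simp_all

text \<open>Heads are exactly the letters of rank 2, and the rank rises strictly to the right of a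
  head.\<close>

lemma head_unique:
  assumes "valid u" "is_head (u i)" "is_head (u j)"
  shows "i = j"
proof -
  have "rk (u i) = 2" "rk (u j) = 2"
    using assms valid_letter[OF assms(1)] is_head_rk by auto
  then show ?thesis
    using valid_head_less[OF assms(1,2), of j] valid_head_less[OF assms(1,3), of i] by force
qed

section \<open>The transition rule and its nine moves\<close>

text \<open>The arguments are the cell left of the head, the head, and the two cells right of it.\<close>
definition rule :: "cell \<Rightarrow> cell \<Rightarrow> cell \<Rightarrow> cell \<Rightarrow> cell \<times> cell \<times> cell \<times> cell" where
  "rule a b y z = (case b of
     Call c \<Rightarrow>
       if a = Trail then (Call c, Blank c, y, z)
       else if c \<noteq> 0 \<and> y = Blank c then (a, Call 0, Wall c 0 True, z)
       else (a, Return c, y, z)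
   | Return c \<Rightarrow>
       (case y of
          Wall p i m \<Rightarrow>
            if m then
              if z = Blank p then (a, Trail, Call (child p (nxt i)), Wall p (nxt i) True)
              else (a, Call c, Wall p i False, z)
            else
              if a = Trail then (Call (child p (prv i)), Wall p (prv i) False, Blank p, z)
              else if i = 0 then (a, Return p, Blank p, z)
              else (a, Call c, Wall p i True, z)
        | _ \<Rightarrow> (a, Trail, Return c, z))
   | _ \<Rightarrow> (a, b, y, z))"

definition upd :: "(int \<Rightarrow> cell) \<Rightarrow> int \<Rightarrow> int \<Rightarrow> cell" where
  "upd u h = (case rule (u (h - 1)) (u h) (u (h + 1)) (u (h + 2)) of
     (a, b, c, d) \<Rightarrow> u(h - 1 := a, h := b, h + 1 := c, h + 2 := d))"

definition tick :: "(int \<Rightarrow> cell) \<Rightarrow> int \<Rightarrow> cell" where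
  "tick u = (if \<exists>h. is_head (u h) then upd u (THE h. is_head (u h)) else u)"

lemma tick_head: "valid u \<Longrightarrow> is_head (u h) \<Longrightarrow> tick u = upd u h"
  unfolding tick_def using head_unique by (metis (no_types, lifting) theI)

lemma tick_no_head: "\<forall>h. \<not> is_head (u h) \<Longrightarrow> tick u = u"
  by (simp add: tick_def)

text \<open>On a valid row \<open>adj\<close> excludes all other neighbourhoods of the head. Time
  reversal exchanges \<open>walk_left\<close> with \<open>walk_right\<close>, \<open>create\<close>
  with \<open>remove\<close> and \<open>grow\<close> with \<open>shrink\<close>;
  \<open>turn\<close>, \<open>reverse\<close> and \<open>restart\<close> are their own reversals. In
  \<open>restart\<close> a backwards run has no trail left to shrink into, but \<open>i > 0\<close>
  shows that the wall is not in the state made by \<open>create\<close>.\<close>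

lemma head_cases:
  assumes v: "valid u" and h: "is_head (u h)"
  obtains
    (walk_left) c where "u (h - 1) = Trail" "u h = Call c" "fits c (u (h + 1))" "c \<le> n"
      "tick u = u(h - 1 := Call c, h := Blank c)"
  | (turn) c where "u (h - 1) = Void" "u h = Call c" "fits c (u (h + 1))" "c \<le> n"
      "c = 0 \<or> (\<exists>p i m. u (h + 1) = Wall p i m)" "tick u = u(h := Return c)"
  | (create) c where "u (h - 1) = Void" "u h = Call c" "u (h + 1) = Blank c" "0 < c" "c \<le> n"
      "tick u = u(h := Call 0, h + 1 := Wall c 0 True)"
  | (walk_right) c where "u (h - 1) \<in> {Void, Trail}" "u h = Return c" "u (h + 1) = Blank c" "c \<le> n"
      "tick u = u(h := Trail, h + 1 := Return c)"
  | (grow) p i where "u (h - 1) \<in> {Void, Trail}" "u h = Return (child p i)"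
      "u (h + 1) = Wall p i True" "u (h + 2) = Blank p" "0 < p" "p \<le> n" "i \<le> n"
      "tick u = u(h := Trail, h + 1 := Call (child p (nxt i)), h + 2 := Wall p (nxt i) True)"
  | (reverse) p i q j m where "u (h - 1) \<in> {Void, Trail}" "u h = Return (child p i)"
      "u (h + 1) = Wall p i True" "u (h + 2) = Wall q j m" "child q j = p" "0 < p" "p \<le> n" "i \<le> n"
      "tick u = u(h := Call (child p i), h + 1 := Wall p i False)"
  | (shrink) p i where "u (h - 1) = Trail" "u h = Return (child p i)"
      "u (h + 1) = Wall p i False" "fits p (u (h + 2))" "0 < p" "p \<le> n" "i \<le> n"
      "tick u = u(h - 1 := Call (child p (prv i)), h := Wall p (prv i) False, h + 1 := Blank p)"
  | (remove) p where "u (h - 1) = Void" "u h = Return 0"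
      "u (h + 1) = Wall p 0 False" "fits p (u (h + 2))" "0 < p" "p \<le> n"
      "tick u = u(h := Return p, h + 1 := Blank p)"
  | (restart) p i where "u (h - 1) = Void" "u h = Return (child p i)"
      "u (h + 1) = Wall p i False" "fits p (u (h + 2))" "0 < p" "p \<le> n" "0 < i" "i \<le> n"
      "tick u = u(h := Call (child p i), h + 1 := Wall p i True)"
proof -
  have a: "adj (u (h - 1)) (u h)" "adj (u h) (u (h + 1))" "adj (u (h + 1)) (u (h + 2))"
    using valid_adj[OF v, of "h - 1"] valid_adj[OF v, of h] valid_adj[OF v, of "h + 1"]
    by (simp_all add: add.commute)
  have l: "letter (u h)" "letter (u (h + 1))"
    using valid_letter[OF v] by auto
  have left: "u (h - 1) = Void \<or> u (h - 1) = Trail"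
    using a(1) h by (cases "u (h - 1)"; cases "u h") auto
  have tick: "tick u k =
     (let (a, b, c, d) = rule (u (h - 1)) (u h) (u (h + 1)) (u (h + 2))
      in if k = h - 1 then a else if k = h then b else if k = h + 1 then c
         else if k = h + 2 then d else u k)" for k
    by (simp add: tick_head[OF v h] upd_def split_beta)
  \<comment> \<open>As a rule, this reduces a goal \<open>tick u = w\<close> to evaluating
    \<open>rule\<close> cell by cell.\<close>
  note tick = ext[OF tick[unfolded rule_def, THEN trans]]
  show ?thesis
  proof (cases "u h")
    case [simp]: (Call c)
    show ?thesis
    proof (cases "u (h - 1) = Trail")
      case True
      then show ?thesis
        using a l by (intro walk_left[of c]) (simp_all, (rule tick, simp)?)
    next
      case False
      then have [simp]: "u (h - 1) = Void"
        using left by auto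
      show ?thesis
      proof (cases "u (h + 1)")
        case [simp]: (Blank d)
        show ?thesis
        proof (cases "c = 0")
          case True
          then show ?thesis
            using a l by (intro turn[of c]) (simp_all, (rule tick, simp)?)
        next
          case False
          then show ?thesis
            using a l by (intro create[of c]) (simp_all, (rule tick, simp)?)
        qed
      next
        case (Wall p i m)
        then show ?thesis
          using a l by (intro turn[of c]) (simp_all, (rule tick, simp)?)
      qed (use a in auto)
    qed
  next
    case [simp]: (Return c)
    show ?thesis
    proof (cases "u (h + 1)")
      case (Blank d)
      then show ?thesis
        using a l left by (intro walk_right[of c]) (simp_all, (rule tick, simp)?)
    next
      case [simp]: (Wall p i m)
      then have [simp]: "c = child p i"
        using a by simp
      have p: "0 < p" "p \<le> n" "i \<le> n"
        using l by auto
      show ?thesis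
      proof (cases m)
        case [simp]: True
        show ?thesis
        proof (cases "u (h + 2)")
          case (Blank d)
          then show ?thesis
            using a p left by (intro grow[of p i]) (simp_all, (rule tick, simp)?)
        next
          case (Wall q j m')
          then show ?thesis
            using a p left by (intro reverse[of p i q j m']) (simp_all, (rule tick, simp)?)
        qed (use a in auto)
      next
        case [simp]: False
        show ?thesis
        proof (cases "u (h - 1) = Trail")
          case True
          then show ?thesis
            using a p by (intro shrink[of p i]) (simp_all, (rule tick, simp)?)
        next
          case False
          then have [simp]: "u (h - 1) = Void"
            using left by auto
          show ?thesis
          proof (cases "i = 0")
            case True
            then show ?thesis
              using a p by (intro remove[of p]) (simp_all, (rule tick, simp)?)
          next
            case False
            then show ?thesis
              using a p by (intro restart[of p i]) (simp_all, (rule tick, simp)?)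
          qed
        qed
      qed
    qed (use a in auto)
  qed (use h in auto)
qed

lemma tick_apply:
  assumes "valid u" "is_head (u h)"
  shows "tick u k =
     (let (a, b, c, d) = rule (u (h - 1)) (u h) (u (h + 1)) (u (h + 2))
      in if k = h - 1 then a else if k = h then b else if k = h + 1 then c
         else if k = h + 2 then d else u k)"
  by (simp add: tick_head[OF assms] upd_def split_beta)

text \<open>Needed when the head steps left onto a trail cell, in \<open>walk_left\<close> and
  \<open>shrink\<close>.\<close>

lemma adj_Trail_head: "adj a Trail \<Longrightarrow> is_head b \<Longrightarrow> adj a b"
  by (cases a) auto

lemma valid_tick:
  assumes v: "valid u"
  shows "valid (tick u)"
proof (cases "\<exists>h. is_head (u h)")
  case True
  then obtain h where h: "is_head (u h)"
    by blast
  have a: "adj (u (h - 2)) (u (h - 1))" "adj (u (h - 1)) (u h)" "adj (u h) (u (h + 1))"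
    "adj (u (h + 1)) (u (h + 2))" "adj (u (h + 2)) (u (h + 3))"
    using valid_adj[OF v, of "h - 2"] valid_adj[OF v, of "h - 1"] valid_adj[OF v, of h]
      valid_adj[OF v, of "h + 1"] valid_adj[OF v, of "h + 2"]
    by (simp_all add: add.commute)
  have l: "letter (u h)" "letter (u (h + 1))"
    using valid_letter[OF v] by auto
  \<comment> \<open>Only the four cells from \<open>h - 1\<close> to \<open>h + 2\<close> can
    change, so five adjacencies remain to be checked.\<close>
  have *: "valid w" if out: "\<And>i. i < h - 1 \<or> i > h + 2 \<Longrightarrow> w i = u i"
    and "adj (w (h - 2)) (w (h - 1))" "adj (w (h - 1)) (w h)" "adj (w h) (w (h + 1))"
      "adj (w (h + 1)) (w (h + 2))" "adj (w (h + 2)) (w (h + 3))"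
    and "letter (w (h - 1))" "letter (w h)" "letter (w (h + 1))" "letter (w (h + 2))" for w
    unfolding valid_def
  proof
    fix i
    consider "i = h - 2" | "i = h - 1" | "i = h" | "i = h + 1" | "i = h + 2"
      | "i + 1 < h - 1" | "i > h + 2"
      by force
    then show "letter (w i) \<and> adj (w i) (w (i + 1))"
      using that valid_adj[OF v, of i] valid_letter[OF v, of i] by cases (simp_all add: add.commute)
  qed
  note letters = valid_letter[OF v]
  from v h show ?thesis
  proof (cases rule: head_cases)
    case (walk_left c)
    then show ?thesis
      using a letters[of "h + 1"] letters[of "h + 2"] by (intro *) (auto intro: adj_Trail_head)
  next
    case (turn c)
    then show ?thesis
      using a letters[of "h + 1"] letters[of "h + 2"] by (intro *) auto
  next
    case (create c)
    then show ?thesis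
      using a letters[of "h + 2"] by (intro *) auto
  next
    case (walk_right c)
    then show ?thesis
      using a letters[of "h + 2"] by (intro *) auto
  next
    case (grow p i)
    then show ?thesis
      using a nxt_le[of i] child_le[of p "nxt i"] by (intro *) (auto intro: order_trans)
  next
    case (reverse p i q j m)
    then show ?thesis
      using a l letters[of "h + 2"] by (intro *) auto
  next
    case (shrink p i)
    then show ?thesis
      using a prv_le[of i] child_le[of p "prv i"] letters[of "h + 2"]
      by (intro *) (auto intro: order_trans adj_Trail_head)
  next
    case (remove p)
    then show ?thesis
      using a letters[of "h + 2"] by (intro *) auto
  next
    case (restart p i)
    then show ?thesis
      using a l letters[of "h + 2"] by (intro *) auto
  qed
qed (use v in \<open>simp add: tick_no_head\<close>)

section \<open>Reversibility\<close>

text \<open>Swapping calls with returns and forwards with backwards reverses time.\<close>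
lemma tick_flip_tick:
  assumes v: "valid u"
  shows "tick (flip \<circ> tick u) = flip \<circ> u"
proof (cases "\<exists>h. is_head (u h)")
  case True
  then obtain h where h: "is_head (u h)"
    by blast
  define w where "w = flip \<circ> tick u"
  have "valid w"
    unfolding w_def by (intro valid_flip valid_tick v)
  note tick = tick_apply[OF this]
  have [simp]: "w j = flip (tick u j)" for j
    by (simp add: w_def)
  from v h have "tick w = flip \<circ> u"
  proof (cases rule: head_cases)
    case (walk_left c)
    then show ?thesis
      by (intro ext) (simp add: tick[of "h - 1"] rule_def)
  next
    case (turn c)
    then show ?thesis
      by (intro ext) (auto simp: tick[of h] rule_def)
  next
    case (create c)
    then show ?thesis
      by (intro ext) (simp add: tick[of h] rule_def)
  next
    case (walk_right c)
    then show ?thesis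
      by (intro ext) (auto simp: tick[of "h + 1"] rule_def)
  next
    case (grow p i)
    then show ?thesis
      by (intro ext) (auto simp: tick[of "h + 1"] rule_def prv_nxt add.commute[of 2])
  next
    case (reverse p i q j m)
    then show ?thesis
      by (intro ext) (auto simp: tick[of h] rule_def)
  next
    case (shrink p i)
    then show ?thesis
      by (intro ext) (auto simp: tick[of "h - 1"] rule_def nxt_prv add.commute[of 1])
  next
    case (remove p)
    then show ?thesis
      by (intro ext) (auto simp: tick[of h] rule_def)
  next
    case (restart p i)
    then show ?thesis
      by (intro ext) (auto simp: tick[of h] rule_def)
  qed
  then show ?thesis
    by (simp add: w_def)
next
  case False
  then show ?thesis
    by (simp add: tick_no_head)
qed

text \<open>A row is recovered from its successor by flipping, ticking and flipping again.\<close>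

lemma inj_tick: "inj_on tick {u. valid u}"
proof (rule inj_onI)
  fix u w assume "u \<in> {u. valid u}" "w \<in> {u. valid u}" "tick u = tick w"
  then have "flip \<circ> u = flip \<circ> w"
    using tick_flip_tick by (metis mem_Collect_eq)
  then show "u = w"
    by (metis comp_apply ext flip_flip)
qed

section \<open>Countability of the set of valid rows\<close>

lemma valid_rk_eq: "valid u \<Longrightarrow> i \<le> j \<Longrightarrow> rk (u i) = rk (u j) \<Longrightarrow> u i = u j"
proof -
  assume v: "valid u" and "i \<le> j" "rk (u i) = rk (u j)"
  from this(2,3) show ?thesis
  proof (induction j rule: int_ge_induct)
    case (step j)
    have "rk (u i) \<le> rk (u j)" "rk (u j) \<le> rk (u (j + 1))"
      using step.hyps by (auto intro!: valid_mono[OF v])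
    then have "rk (u i) = rk (u j)" "rk (u j) = rk (u (j + 1))"
      using step.prems by auto
    moreover have "u j = u (j + 1)"
      using adj_rk[OF valid_letter[OF v] valid_adj[OF v, of j]] calculation by auto
    ultimately show ?case
      using step.IH by simp
  qed simp
qed

text \<open>The rank is monotone with finitely many values, so a row is constant to the left of some
  \<open>b\<close> and to the right of some \<open>a\<close>. A finite window determines it;
  \<open>dec\<close> clamps positions outside the window to its ends.\<close>

lemma countable_valid: "countable {u. valid u}"
proof -
  define dec :: "int \<times> cell list \<Rightarrow> int \<Rightarrow> cell" where
    "dec = (\<lambda>(N, xs) j. xs ! nat (max (- N) (min N j) + N))"
  have "u \<in> range dec" if v: "valid u" for u
  proof -
    have fin: "finite (range (rk \<circ> u))"
      by (rule finite_subset[OF _ finite_imageI[OF finite_letters, of rk]])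
        (auto simp: valid_letter[OF v])
    obtain a where a: "\<And>j. rk (u j) \<le> rk (u a)"
      using Max_in[OF fin] Max_ge[OF fin] by (auto simp: image_iff) (metis rangeI)
    obtain b where b: "\<And>j. rk (u b) \<le> rk (u j)"
      using Min_in[OF fin] Min_le[OF fin] by (auto simp: image_iff) (metis rangeI)
    define N where "N = max \<bar>a\<bar> \<bar>b\<bar>"
    have up: "u j = u a" if "a \<le> j" for j
      using valid_rk_eq[OF v that] a[of j] valid_mono[OF v that] by simp
    have down: "u j = u b" if "j \<le> b" for j
      using valid_rk_eq[OF v that] b[of j] valid_mono[OF v that] by simp
    have "u j = dec (N, map u [-N..N]) j" for j
    proof -
      have N: "- N \<le> b" "a \<le> N" "0 \<le> N"
        by (auto simp: N_def)
      have "dec (N, map u [-N..N]) j = u (max (- N) (min N j))"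
        using N by (simp add: dec_def nth_upto)
      also have "\<dots> = u j"
        using N up[of N] up[of j] down[of "- N"] down[of j] by (auto simp: max_def min_def)
      finally show ?thesis
        by simp
    qed
    then show ?thesis
      by blast
  qed
  then have "{u. valid u} \<subseteq> range dec"
    by blast
  then show ?thesis
    by (rule countable_subset) simp
qed

section \<open>Programs that can occur in a run\<close>

text \<open>The trivial program \<open>0\<close> counts as below every program, because it replaces
  missing children.\<close>

definition weakly_below :: "nat \<Rightarrow> nat \<Rightarrow> bool" where
  "weakly_below c q \<longleftrightarrow> c = 0 \<or> c = q \<or> lt c q"

fun below :: "nat \<Rightarrow> cell \<Rightarrow> bool" where
  "below q (Blank c) \<longleftrightarrow> weakly_below c q"
| "below q (Call c) \<longleftrightarrow> weakly_below c q"
| "below q (Return c) \<longleftrightarrow> weakly_below c q"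
| "below q (Wall p i m) \<longleftrightarrow> weakly_below p q"
| "below q _ \<longleftrightarrow> True"

lemma weakly_below_child: "weakly_below p q \<Longrightarrow> weakly_below (child p i) q"
  using lt_less lt_trans by (fastforce simp: weakly_below_def child_def)

text \<open>A move writes only programs already on the row, children of the owner of a wall, and
  \<open>0\<close>; transitivity of \<open>lt\<close> keeps these below \<open>q\<close>.\<close>

lemma below_tick:
  assumes v: "valid u" and b: "\<And>j. below q (u j)"
  shows "below q (tick u j)"
proof (cases "\<exists>h. is_head (u h)")
  case True
  then obtain h where h: "is_head (u h)"
    by blast
  have "weakly_below 0 q"
    by (simp add: weakly_below_def)
  with v h show ?thesis
    by (cases rule: head_cases) (use b[of "h - 1"] b[of h] b[of "h + 1"] b in \<open>auto intro: weakly_below_child\<close>)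
qed (use b in \<open>simp add: tick_no_head\<close>)


section \<open>Runs confined by a wall\<close>

text \<open>A call of \<open>c\<close> on its way to the border of the void, which is fixed at
  position 0; the background \<open>w\<close> shows to the right of the head.\<close>

definition sweep :: "nat \<Rightarrow> (int \<Rightarrow> cell) \<Rightarrow> int \<Rightarrow> int \<Rightarrow> cell" where
  "sweep c w h j = (if j \<le> 0 then Void else if j < h then Trail else if j = h then Call c else w j)"

lemma valid_sweep:
  assumes "1 \<le> h" "c \<le> n" "fits c (w (h + 1))" "\<And>j. h < j \<Longrightarrow> letter (w j) \<and> adj (w j) (w (j + 1))"
  shows "valid (sweep c w h)"
  unfolding valid_def
proof
  fix j
  consider "j < 0" | "j = 0" | "0 < j" "j < h" | "j = h" | "h < j"
    by linarith
  then show "letter (sweep c w h j) \<and> adj (sweep c w h j) (sweep c w h (j + 1))"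
    using assms by cases (auto simp: sweep_def)
qed

lemma tick_sweep:
  assumes "valid (sweep c w h)" "2 \<le> h" "w h = Blank c"
  shows "tick (sweep c w h) = sweep c w (h - 1)"
  using assms(2,3) by (intro ext) (auto simp: tick_apply[OF assms(1), of h] rule_def sweep_def)

text \<open>The background while an outermost \<open>q\<close> calls its child of index
  \<open>i\<close>; the blanks beyond \<open>N\<close> leave its wall room to advance.\<close>

definition wall :: "nat \<Rightarrow> nat \<Rightarrow> int \<Rightarrow> int \<Rightarrow> cell" where
  "wall q i N j = (if j < N then Blank (child q i) else if j = N then Wall q i True else Blank q)"

lemma valid_wall:
  assumes "0 < q" "q \<le> n" "i \<le> n" "1 \<le> h" "h < N"
  shows "valid (sweep (child q i) (wall q i N) h)"
  using assms child_le[of q i] by (intro valid_sweep) (auto simp: wall_def)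

text \<open>The head works strictly to the left of the wall at \<open>N\<close>, while the void and
  everything from \<open>N\<close> on stay frozen. Only the cells from 1 to \<open>N - 1\<close> are
  free, so there are finitely many such rows.\<close>

definition confined :: "nat \<Rightarrow> nat \<Rightarrow> int \<Rightarrow> (int \<Rightarrow> cell) set" where
  "confined q i N = {u. valid u \<and> (\<forall>j. u j = Void \<longleftrightarrow> j \<le> 0) \<and> (\<forall>j\<ge>N. u j = wall q i N j) \<and>
     (\<exists>h<N. is_head (u h))}"

lemma finite_confined: "finite (confined q i N)"
proof (rule inj_on_finite)
  show "inj_on (\<lambda>u. restrict u {1..<N}) (confined q i N)"
  proof (rule inj_onI, rule ext)
    fix u w j
    assume u: "u \<in> confined q i N" and w: "w \<in> confined q i N"
      and eq: "restrict u {1..<N} = restrict w {1..<N}"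
    consider "j \<le> 0" | "1 \<le> j" "j < N" | "N \<le> j"
      by linarith
    then show "u j = w j"
    proof cases
      case 1
      then have "u j = Void" "w j = Void"
        using u w unfolding confined_def by blast+
      then show ?thesis
        by simp
    next
      case 2
      then show ?thesis
        using fun_cong[OF eq, of j] by simp
    next
      case 3
      then show ?thesis
        using u w by (simp add: confined_def)
    qed
  qed
  show "(\<lambda>u. restrict u {1..<N}) ` confined q i N \<subseteq> {1..<N} \<rightarrow>\<^sub>E Collect letter"
    by (auto simp: confined_def valid_letter)
  show "finite ({1..<N} \<rightarrow>\<^sub>E Collect letter)"
    by (intro finite_PiE finite_letters) auto
qed

text \<open>The head can alter the wall at \<open>N\<close> only as a \<open>Return\<close> at
  \<open>N - 1\<close>. A move to the left needs a trail cell, so it never enters the void.\<close>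

lemma tick_confined:
  assumes u: "u \<in> confined q i N" and nr: "\<And>c. u (N - 1) \<noteq> Return c"
  shows "tick u \<in> confined q i N"
proof -
  have v: "valid u" and Void: "\<And>j. u j = Void \<longleftrightarrow> j \<le> 0"
    and w: "\<And>j. N \<le> j \<Longrightarrow> u j = wall q i N j"
    using u by (auto simp: confined_def)
  obtain h where h: "is_head (u h)" "h < N"
    using u by (auto simp: confined_def)
  have "0 < h"
    using Void[of h] h by force
  have N: "u N = Wall q i True"
    using w[of N] by (simp add: wall_def)
  \<comment> \<open>\<open>R\<close>, \<open>B1\<close> and \<open>B2\<close> keep the rewritten
    cells left of \<open>N\<close>: a returning head is not at \<open>N - 1\<close>, and a cell that
    is blank is not the wall at \<open>N\<close>.\<close>
  have R: "h + 1 < N" if "u h = Return c" for c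
    using nr[of c] that h(2) by (cases "h = N - 1") auto
  have B1: "h + 1 < N" if "u (h + 1) = Blank c" for c
    using that N h(2) by (cases "h + 1 = N") auto
  have B2: "h + 2 < N" if "u (h + 2) = Blank c" "h + 1 < N" for c
    using that N h(2) by (cases "h + 2 = N") auto
  have T: "1 < h" if "u (h - 1) = Trail"
    using Void[of "h - 1"] that by force
  have *: "tick u \<in> confined q i N" if "\<And>j. tick u j = Void \<longleftrightarrow> j \<le> 0" "\<And>j. N \<le> j \<Longrightarrow> tick u j = u j"
    "is_head (tick u g)" "g < N" for g
    using that w valid_tick[OF v] by (auto simp: confined_def)
  from v h(1) show ?thesis
  proof (cases rule: head_cases)
    case (walk_left c)
    then show ?thesis
      using T \<open>0 < h\<close> h by (intro *[of "h - 1"]) (auto simp: Void)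
  next
    case (turn c)
    then show ?thesis
      using \<open>0 < h\<close> h by (intro *[of h]) (auto simp: Void)
  next
    case (create c)
    then show ?thesis
      using \<open>0 < h\<close> h B1 by (intro *[of h]) (auto simp: Void)
  next
    case (walk_right c)
    then show ?thesis
      using \<open>0 < h\<close> h B1 by (intro *[of "h + 1"]) (auto simp: Void)
  next
    case (grow p i)
    then show ?thesis
      using \<open>0 < h\<close> h R B2 by (intro *[of "h + 1"]) (auto simp: Void)
  next
    case (reverse p i q j m)
    then show ?thesis
      using \<open>0 < h\<close> h R by (intro *[of h]) (auto simp: Void)
  next
    case (shrink p i)
    then show ?thesis
      using \<open>0 < h\<close> h R T by (intro *[of "h - 1"]) (auto simp: Void)
  next
    case (remove p)
    then show ?thesis
      using \<open>0 < h\<close> h R by (intro *[of h]) (auto simp: Void)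
  next
    case (restart p i)
    then show ?thesis
      using \<open>0 < h\<close> h R by (intro *[of h]) (auto simp: Void)
  qed
qed

definition exit_row :: "nat \<Rightarrow> nat \<Rightarrow> int \<Rightarrow> int \<Rightarrow> cell" where
  "exit_row q i N j = (if j \<le> 0 then Void else if j < N - 1 then Trail
     else if j = N - 1 then Return (child q i) else wall q i N j)"

lemma confined_exit:
  assumes u: "u \<in> confined q i N" and r: "u (N - 1) = Return c"
  shows "u = exit_row q i N"
proof
  fix j
  have v: "valid u" and Void: "\<And>j. u j = Void \<longleftrightarrow> j \<le> 0"
    and w: "\<And>j. N \<le> j \<Longrightarrow> u j = wall q i N j"
    using u by (auto simp: confined_def)
  consider "j \<le> 0" | "0 < j" "j < N - 1" | "0 < j" "j = N - 1" | "0 < j" "N \<le> j"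
    by linarith
  then show "u j = exit_row q i N j"
  proof cases
    case 2
    have "u j \<noteq> Void" "\<not> is_head (u j)"
      using 2 Void head_unique[OF v, of j "N - 1"] r by auto
    moreover have "rk (u j) \<le> 2" "letter (u j)"
      using valid_mono[OF v, of j "N - 1"] 2 r valid_letter[OF v] by auto
    ultimately have "u j = Trail"
      by (cases "u j") auto
    with 2 show ?thesis
      by (simp add: exit_row_def)
  next
    case 3
    have "c = child q i"
      using valid_adj[OF v, of "N - 1"] r w[of N] by (simp add: wall_def)
    with 3 r show ?thesis
      by (simp add: exit_row_def)
  qed (use Void w in \<open>auto simp: exit_row_def\<close>)
qed

text \<open>
  The entry row has no predecessor among the finitely many confined rows, so by injectivity its
  orbit cannot stay confined; the only way out is the exit row.
\<close>
lemma call_returns: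
  assumes "0 < q" "q \<le> n" "i \<le> n" "2 \<le> N"
  shows "\<exists>k. (tick ^^ k) (sweep (child q i) (wall q i N) (N - 1)) = exit_row q i N"
proof (rule ccontr)
  define e where "e = sweep (child q i) (wall q i N) (N - 1)"
  assume "\<not> ?thesis"
  then have no_exit: "(tick ^^ k) e \<noteq> exit_row q i N" for k
    by (auto simp: e_def)
  have ve: "valid e"
    unfolding e_def using assms by (intro valid_wall) auto
  have e: "e \<in> confined q i N"
    unfolding confined_def using ve assms(4)
    by (auto simp: e_def sweep_def wall_def intro!: exI[of _ "N - 1"])
  have conf: "(tick ^^ k) e \<in> confined q i N" for k
  proof (induction k)
    case (Suc k)
    have "tick ((tick ^^ k) e) \<in> confined q i N"
      using confined_exit[OF Suc] no_exit by (intro tick_confined Suc) blast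
    then show ?case
      by simp
  qed (use e in simp)
  then have valid: "valid ((tick ^^ k) e)" for k
    by (auto simp: confined_def)
  have "finite (range (\<lambda>k. (tick ^^ k) e))"
    by (rule finite_subset[OF _ finite_confined]) (use conf in blast)
  then have "\<not> inj (\<lambda>k. (tick ^^ k) e)"
    using finite_imageD[of "\<lambda>k. (tick ^^ k) e" UNIV] infinite_UNIV_nat by auto
  then obtain a b where ab: "(tick ^^ a) e = (tick ^^ b) e" "a < b"
    by (metis (mono_tags, lifting) injI linorder_neqE_nat)
  have "(tick ^^ a) e = (tick ^^ (a + d)) e \<Longrightarrow> e = (tick ^^ d) e" for a d
  proof (induction a)
    case (Suc a)
    have "(tick ^^ a) e = (tick ^^ (a + d)) e"
      using inj_onD[OF inj_tick, of "(tick ^^ a) e" "(tick ^^ (a + d)) e"] valid Suc.prems by simp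
    then show ?case
      by (rule Suc.IH)
  qed simp
  moreover obtain d where "b = a + Suc d"
    using less_imp_Suc_add[OF ab(2)] by auto
  ultimately have "e = (tick ^^ Suc d) e"
    using ab(1) by blast
  then have pre: "tick ((tick ^^ d) e) = e"
    by (metis comp_apply funpow.simps(2))
  \<comment> \<open>A predecessor of \<open>e\<close> is computed by running the flipped row. There
    a \<open>Return\<close> meets the wall at \<open>N\<close> running backwards, and each
    applicable move changes that wall, whereas a confined predecessor has it unchanged.\<close>
  define w where "w = flip \<circ> e"
  have vw: "valid w"
    unfolding w_def by (rule valid_flip[OF ve])
  have "flip \<circ> (tick ^^ d) e = tick w"
    using tick_flip_tick[OF valid, of d] pre by (simp add: w_def)
  then have "flip ((tick ^^ d) e N) = tick w N"
    by (metis comp_apply)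
  moreover have "(tick ^^ d) e N = Wall q i True"
    using conf[of d] by (simp add: confined_def wall_def)
  ultimately have "tick w N = Wall q i False"
    by simp
  moreover have "tick w N \<noteq> Wall q i False"
  proof -
    have "w (N - 1) = Return (child q i)" "w N = Wall q i False"
      using assms(4) by (auto simp: w_def e_def sweep_def wall_def)
    then show ?thesis
      by (simp add: tick_apply[OF vw, of "N - 1"] rule_def)
  qed
  ultimately show False
    by contradiction
qed

section \<open>The run of a program in unbounded space\<close>

text \<open>This is the move \<open>grow\<close>: the cell beyond the wall is
  \<open>Blank q\<close>, so the wall advances and the next child gets one more cell of
  space.\<close>

lemma tick_exit_row:
  assumes "0 < q" "q \<le> n" "i \<le> n" "2 \<le> N" "valid (exit_row q i N)"
  shows "tick (exit_row q i N) = sweep (child q (nxt i)) (wall q (nxt i) (N + 1)) N"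
  using assms(4) by (intro ext)
    (auto simp: tick_apply[OF assms(5), of "N - 1"] rule_def exit_row_def sweep_def wall_def)

definition start :: "nat \<Rightarrow> int \<Rightarrow> cell" where
  "start q = sweep q (\<lambda>_. Blank q) 1"

lemma valid_start: "q \<le> n \<Longrightarrow> 1 \<le> h \<Longrightarrow> valid (sweep q (\<lambda>_. Blank q) h)"
  by (intro valid_sweep) auto

lemma tick_start:
  assumes "0 < q" "q \<le> n"
  shows "tick (start q) = sweep (child q 0) (wall q 0 2) 1"
  using assms(1) unfolding start_def
  by (intro ext)
    (auto simp: tick_apply[OF valid_start[OF assms(2), of 1], of 1] rule_def sweep_def wall_def)

text \<open>Each round consists of \<open>call_returns\<close> followed by
  \<open>tick_exit_row\<close>. Since the index cycles while the wall advances, every child is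
  called in arbitrarily large spaces.\<close>

lemma reaches_calls:
  assumes "0 < q" "q \<le> n"
  shows "\<exists>s>0. (tick ^^ s) (start q) =
    sweep (child q (k mod Suc n)) (wall q (k mod Suc n) (int k + 2)) (int k + 1)"
proof (induction k)
  case 0
  then show ?case
    using tick_start[OF assms] by (intro exI[of _ 1]) simp
next
  case (Suc k)
  define i where "i = k mod Suc n"
  have i: "i \<le> n" "Suc k mod Suc n = nxt i"
    by (auto simp: i_def nxt_def mod_Suc less_Suc_eq_le[symmetric])
  obtain s where s: "(tick ^^ s) (start q) = sweep (child q i) (wall q i (int k + 2)) (int k + 1)"
    using Suc by (auto simp: i_def)
  obtain r where r: "(tick ^^ r) ((tick ^^ s) (start q)) = exit_row q i (int k + 2)"
    using call_returns[OF assms i(1), of "int k + 2"] s by (auto simp: add.commute[of 1])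
  have "valid ((tick ^^ m) (start q))" for m
    by (induction m) (auto simp: valid_tick start_def valid_start assms(2))
  from this[of "r + s"] have "valid (exit_row q i (int k + 2))"
    using r by (simp add: funpow_add)
  then have "tick (exit_row q i (int k + 2)) = sweep (child q (nxt i)) (wall q (nxt i) (int k + 3)) (int k + 2)"
    using tick_exit_row[OF assms i(1)] by (simp add: add.commute[of 3])
  moreover have "int k + 3 = int (Suc k) + 2" "int k + 2 = int (Suc k) + 1"
    by auto
  ultimately have "(tick ^^ Suc (r + s)) (start q) =
      sweep (child q (nxt i)) (wall q (nxt i) (int (Suc k) + 2)) (int (Suc k) + 1)"
    using r unfolding funpow.simps o_def funpow_add by metis
  then show ?case
    unfolding i(2) by blast
qed

text \<open>Time 0 is the moment at which the call of \<open>q\<close> reaches the void; at earlier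
  times it is still arriving from the right at infinity.\<close>

definition orbit :: "nat \<Rightarrow> int \<Rightarrow> int \<Rightarrow> cell" where
  "orbit q t = (if t \<le> 0 then sweep q (\<lambda>_. Blank q) (1 - t) else (tick ^^ nat t) (start q))"

lemma orbit_nonneg: "0 \<le> t \<Longrightarrow> orbit q t = (tick ^^ nat t) (start q)"
  by (auto simp: orbit_def start_def)

lemma tick_orbit:
  assumes "q \<le> n"
  shows "tick (orbit q t) = orbit q (t + 1)"
proof (cases "t < 0")
  case True
  then show ?thesis
    using tick_sweep[OF valid_start[OF assms, of "1 - t"]] by (simp add: orbit_def)
next
  case False
  then show ?thesis
    by (simp add: orbit_nonneg nat_add_distrib)
qed

lemma valid_orbit:
  assumes "q \<le> n"
  shows "valid (orbit q t)"
proof (cases "t \<le> 0")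
  case True
  then show ?thesis
    using valid_start[OF assms] by (simp add: orbit_def)
next
  case False
  have "valid ((tick ^^ m) (start q))" for m
    by (induction m) (auto simp: valid_tick start_def valid_start assms)
  with False show ?thesis
    by (simp add: orbit_def)
qed

text \<open>Forwards in time this is \<open>below_tick\<close>; at times up to 0 the row is explicit
  and mentions only \<open>q\<close>.\<close>

lemma below_orbit:
  assumes "q \<le> n"
  shows "below q (orbit q t j)"
proof (induction t arbitrary: j rule: int_induct[of _ 0])
  case (step1 t)
  then show ?case
    using below_tick[OF valid_orbit[OF assms], of q t] by (simp add: tick_orbit[OF assms])
qed (auto simp: orbit_def sweep_def weakly_below_def)

section \<open>Runs of smaller programs inside runs of larger ones\<close>

text \<open>The rule reads nothing beyond \<open>h + 2\<close> and moves the head at most one cell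
  to the right, so a distant difference goes unnoticed for a long time.\<close>

lemma tick_local:
  assumes "valid u" "valid w" and eq: "\<And>j. j < N \<Longrightarrow> u j = w j" and "is_head (u h)" "h + 2 < N"
  shows "j < N \<Longrightarrow> tick u j = tick w j" and "\<exists>g\<le>h + 1. is_head (tick u g)"
proof -
  have "is_head (w h)"
    using assms(4,5) eq[of h] by simp
  then show "j < N \<Longrightarrow> tick u j = tick w j"
    using assms(5) eq tick_apply[OF assms(1,4)] tick_apply[OF assms(2)] by (simp split: prod.split)
  from assms(1,4) show "\<exists>g\<le>h + 1. is_head (tick u g)"
  proof (cases rule: head_cases)
    case walk_left
    then show ?thesis by (intro exI[of _ "h - 1"]) simp
  next
    case walk_right
    then show ?thesis by (intro exI[of _ "h + 1"]) simp
  next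
    case grow
    then show ?thesis by (intro exI[of _ "h + 1"]) simp
  next
    case shrink
    then show ?thesis by (intro exI[of _ "h - 1"]) simp
  qed (auto intro!: exI[of _ h])
qed

text \<open>When \<open>q\<close> calls \<open>p\<close> in a large space, the rows agree to the
  left of the wall with those of \<open>p\<close> on a blank tape: before the arrival at the void
  both are sweeps, and afterwards the head needs many steps to notice the wall.\<close>

lemma orbit_contains:
  assumes "lt p q" "0 < p" "q \<le> n"
  shows "\<exists>s. \<forall>t j. \<bar>t\<bar> \<le> int B \<longrightarrow> \<bar>j\<bar> \<le> int B \<longrightarrow> orbit p t j = orbit q (s + t) j"
proof -
  have pq: "0 < q" "p \<le> n"
    using lt_less[OF assms(1)] assms(2,3) by auto
  \<comment> \<open>The residue of \<open>k\<close> selects the child \<open>p\<close>; the multiple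
    of \<open>Suc n\<close> puts the wall beyond every cell read in \<open>B\<close> steps.\<close>
  define k where "k = p + Suc n * (B + 2)"
  define N where "N = int k + 2"
  have "k mod Suc n = p"
    using pq(2) by (simp only: k_def mod_mult_self2 mod_less less_Suc_eq_le)
  moreover have "child q p = p"
    using assms(1) by (simp add: child_def)
  ultimately obtain m where m: "(tick ^^ m) (start q) = sweep p (wall q p N) (N - 1)"
    using reaches_calls[OF pq(1) assms(3), of k] by (auto simp: N_def add.commute[of 1])
  have "B + 2 \<le> k"
    unfolding k_def by simp
  then have B: "int B + 4 \<le> N"
    by (simp add: N_def)
  \<comment> \<open>The call starts at \<open>N - 1\<close> at time \<open>m\<close> and needs
    \<open>N - 2\<close> steps to reach position 1.\<close>
  define s where "s = int m + (N - 2)"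
  have w: "wall q p N j = Blank p" if "j < N" for j
    using that \<open>child q p = p\<close> by (simp add: wall_def)
  have before: "orbit q (s - int d) = sweep p (wall q p N) (1 + int d)" if "int d \<le> N - 2" for d
  proof -
    have "orbit q (int m + int a) = sweep p (wall q p N) (N - 1 - int a)" if "int a \<le> N - 2" for a
      using that
    proof (induction a)
      case (Suc a)
      have "valid (sweep p (wall q p N) (N - 1 - int a))"
        using valid_wall[OF pq(1) assms(3) pq(2), of "N - 1 - int a" N] Suc.prems \<open>child q p = p\<close>
        by simp
      then have "tick (sweep p (wall q p N) (N - 1 - int a)) = sweep p (wall q p N) (N - 1 - int (Suc a))"
        using tick_sweep[of p "wall q p N" "N - 1 - int a"] Suc.prems w by (simp add: algebra_simps)
      with Suc show ?case
        using tick_orbit[OF assms(3), of "int m + int a"] by (simp add: ac_simps)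
    qed (simp add: m orbit_nonneg)
    from this[of "nat (N - 2 - int d)"] that show ?thesis
      by (simp add: s_def algebra_simps)
  qed
  have after: "(\<forall>j<N. orbit p (int d) j = orbit q (s + int d) j) \<and>
      (\<exists>h\<le>1 + int d. is_head (orbit p (int d) h))" if "d \<le> B" for d
    using that
  proof (induction d)
    case 0
    have "orbit p 0 j = orbit q s j" if "j < N" for j
      using before[of 0] B w[OF that] by (simp add: orbit_def sweep_def)
    moreover have "is_head (orbit p 0 1)"
      by (simp add: orbit_def sweep_def)
    ultimately show ?case
      by auto
  next
    case (Suc d)
    then obtain h where h: "h \<le> 1 + int d" "is_head (orbit p (int d) h)"
      and eq: "\<And>j. j < N \<Longrightarrow> orbit p (int d) j = orbit q (s + int d) j"
      by auto
    have "h + 2 < N"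
      using h(1) Suc.prems B by simp
    have "tick (orbit p (int d)) j = tick (orbit q (s + int d)) j" if "j < N" for j
      by (rule tick_local(1)[OF valid_orbit[OF pq(2)] valid_orbit[OF assms(3)] _ h(2) \<open>h + 2 < N\<close> that])
        (rule eq)
    moreover obtain g where "g \<le> h + 1" "is_head (tick (orbit p (int d)) g)"
      using tick_local(2)[OF valid_orbit[OF pq(2)] valid_orbit[OF assms(3)] _ h(2) \<open>h + 2 < N\<close>] eq
      by blast
    ultimately show ?case
      using h(1) unfolding tick_orbit[OF pq(2)] tick_orbit[OF assms(3)]
      by (intro conjI exI[of _ g]) (simp_all add: ac_simps)
  qed
  have "orbit p t j = orbit q (s + t) j" if "\<bar>t\<bar> \<le> int B" "\<bar>j\<bar> \<le> int B" for t j
  proof (cases "0 \<le> t")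
    case True
    with that B after[of "nat t"] show ?thesis
      by auto
  next
    case False
    with that B before[of "nat (- t)"] w[of j] show ?thesis
      by (simp add: orbit_def sweep_def)
  qed
  then show ?thesis
    by blast
qed

section \<open>Local conditions and finite type\<close>

text \<open>Replaces the global search for the head by conditions on bounded windows. A head at
  \<open>h\<close> writes the cells from \<open>h - 1\<close> to \<open>h + 2\<close>, so cell
  \<open>a\<close> is affected only by heads from \<open>a - 2\<close> to
  \<open>a + 1\<close>.\<close>

lemma tick_iff_local:
  assumes v: "valid u"
  shows "w = tick u \<longleftrightarrow>
    (\<forall>a. (is_head (u a) \<longrightarrow>
            (w (a - 1), w a, w (a + 1), w (a + 2)) = rule (u (a - 1)) (u a) (u (a + 1)) (u (a + 2))) \<and>
         (\<not> is_head (u (a - 2)) \<and> \<not> is_head (u (a - 1)) \<and> \<not> is_head (u a) \<and> \<not> is_head (u (a + 1)) \<longrightarrow>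
            w a = u a))" (is "_ \<longleftrightarrow> (\<forall>a. ?P a \<and> ?Q a)")
proof (cases "\<exists>h. is_head (u h)")
  case False
  then show ?thesis
    by (auto simp: tick_no_head)
next
  case True
  then obtain h where h: "is_head (u h)"
    by blast
  have eq: "is_head (u a) \<longleftrightarrow> a = h" for a
    using head_unique[OF v h] h by blast
  obtain a' b' c' d' where r: "rule (u (h - 1)) (u h) (u (h + 1)) (u (h + 2)) = (a', b', c', d')"
    by (metis prod_cases4)
  have tick: "tick u = u(h - 1 := a', h := b', h + 1 := c', h + 2 := d')"
    by (simp add: tick_head[OF v h] upd_def r)
  show ?thesis
  proof
    assume "w = tick u"
    then show "\<forall>a. ?P a \<and> ?Q a"
      by (auto simp: eq r tick)
  next
    assume *: "\<forall>a. ?P a \<and> ?Q a"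
    show "w = tick u"
    proof
      fix a
      have "w (h - 1) = a'" "w h = b'" "w (h + 1) = c'" "w (h + 2) = d'"
        using *[rule_format, of h] h r by auto
      moreover have "w a = u a" if "a \<noteq> h - 1" "a \<noteq> h" "a \<noteq> h + 1" "a \<noteq> h + 2"
        using *[rule_format, of a] that by (auto simp: eq)
      ultimately show "w a = tick u a"
        by (auto simp: tick)
    qed
  qed
qed

end

text \<open>The forbidden patterns are those on \<open>D\<close> none of whose extensions satisfies
  \<open>Q\<close>; by locality these are all the violating windows.\<close>

lemma sft_of_local_condition:
  fixes Q :: "('g::ab_group_add \<Rightarrow> 'a) \<Rightarrow> bool"
  assumes "finite S" "finite D" and local: "\<And>x y. (\<And>m. m \<in> D \<Longrightarrow> x m = y m) \<Longrightarrow> Q x = Q y"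
  shows "sft S {x. range x \<subseteq> S \<and> (\<forall>k. Q (shift k x))}"
proof -
  define F where "F = {p. dom p = D \<and> ran p \<subseteq> S \<and> (\<forall>x. (\<forall>m\<in>D. p m = Some (x m)) \<longrightarrow> \<not> Q x)}"
  have fin: "finite F"
    by (rule finite_subset[OF _ finite_set_of_finite_maps[OF assms(2,1)]]) (auto simp: F_def)
  have "(\<forall>k. Q (shift k x)) \<longleftrightarrow> (\<forall>p\<in>F. \<not> occurs p x)" if x: "range x \<subseteq> S" for x
  proof
    assume Q: "\<forall>k. Q (shift k x)"
    show "\<forall>p\<in>F. \<not> occurs p x"
    proof (intro ballI notI)
      fix p assume p: "p \<in> F" "occurs p x"
      then obtain k where "\<forall>m\<in>D. p m = Some (shift k x m)"
        by (auto simp: occurs_def F_def)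
      with p(1) Q show False
        unfolding F_def by blast
    qed
  next
    assume F: "\<forall>p\<in>F. \<not> occurs p x"
    show "\<forall>k. Q (shift k x)"
    proof (rule allI, rule ccontr)
      fix k assume nQ: "\<not> Q (shift k x)"
      define p where "p = (\<lambda>m. if m \<in> D then Some (shift k x m) else None)"
      have D: "dom p = D"
        by (auto simp: p_def split: if_splits)
      have "ran p \<subseteq> S"
        using x by (auto simp: p_def ran_def shift_def split: if_splits)
      moreover have "\<not> Q y" if "\<forall>m\<in>D. p m = Some (y m)" for y
        using local[of y "shift k x"] that nQ by (simp add: p_def)
      ultimately have "p \<in> F"
        using D by (simp add: F_def)
      moreover have "occurs p x"
        unfolding occurs_def D by (auto simp: p_def)
      ultimately show False
        using F by blast
    qed
  qed
  then have eq: "{x. range x \<subseteq> S \<and> (\<forall>k. Q (shift k x))} = {x. range x \<subseteq> S \<and> (\<forall>p\<in>F. \<not> occurs p x)}"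
    by auto
  have "\<forall>p\<in>F. finite (dom p) \<and> ran p \<subseteq> S"
    using assms(2) by (auto simp: F_def)
  then show ?thesis
    unfolding sft_def eq using subshift_avoiding[OF assms(1), of F] fin by blast
qed

lemma vector_2_add [simp]:
  "(vector [a, b] :: int^2) + vector [c, d] = vector [a + c, b + d]"
  by (simp add: vec_eq_iff forall_2)

lemma vector_2_eta [simp]: "vector [v $ 1, v $ 2] = (v :: int^2)"
  by (simp add: vec_eq_iff forall_2)

definition row :: "(int^2 \<Rightarrow> nat) \<Rightarrow> int \<Rightarrow> int \<Rightarrow> cell" where
  "row x b a = from_nat (x (vector [a, b]))"

lemma row_shift: "row (shift (vector [a, b]) x) d c = row x (b + d) (a + c)"
  by (simp add: row_def shift_def)

section \<open>The subshift of space-time diagrams\<close>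

context machine
begin

definition codes :: "nat set" where
  "codes = to_nat ` Collect letter"

lemma finite_codes: "finite codes"
  by (simp add: codes_def finite_letters)

lemma letter_from_nat: "m \<in> codes \<Longrightarrow> letter (from_nat m)"
  and to_from_codes: "m \<in> codes \<Longrightarrow> to_nat (from_nat m :: cell) = m"
  by (auto simp: codes_def)

text \<open>The countable one-dimensional SFT that witnesses the bounded signal property.\<close>

definition valid_codes :: "(int \<Rightarrow> nat) set" where
  "valid_codes = {y. range y \<subseteq> codes \<and> valid (from_nat \<circ> y)}"

lemma sft_valid_codes: "sft codes valid_codes"
proof -
  have "valid (from_nat \<circ> y) \<longleftrightarrow> (\<forall>k. adj (from_nat (shift k y 0)) (from_nat (shift k y 1)))"
    if "range y \<subseteq> codes" for y :: "int \<Rightarrow> nat"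
    using that by (auto simp: valid_def shift_def intro!: letter_from_nat)
  then have "valid_codes =
    {y. range y \<subseteq> codes \<and> (\<forall>k. adj (from_nat (shift k y 0)) (from_nat (shift k y 1)))}"
    by (auto simp: valid_codes_def)
  then show ?thesis
    using sft_of_local_condition[OF finite_codes, of "{0, 1 :: int}" "\<lambda>y. adj (from_nat (y 0)) (from_nat (y 1))"]
    by simp
qed

lemma countable_valid_codes: "countable valid_codes"
proof (rule countable_image_inj_on)
  show "countable ((\<lambda>y. from_nat \<circ> y :: int \<Rightarrow> cell) ` valid_codes)"
    by (rule countable_subset[OF _ countable_valid]) (auto simp: valid_codes_def)
  show "inj_on (\<lambda>y. from_nat \<circ> y :: int \<Rightarrow> cell) valid_codes"
  proof (rule inj_onI, rule ext)
    fix y z k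
    assume "y \<in> valid_codes" "z \<in> valid_codes" and eq: "(from_nat \<circ> y :: int \<Rightarrow> cell) = from_nat \<circ> z"
    then have "y k \<in> codes" "z k \<in> codes"
      by (auto simp: valid_codes_def)
    moreover have "(from_nat (y k) :: cell) = from_nat (z k)"
      using fun_cong[OF eq, of k] by simp
    ultimately show "y k = z k"
      using to_from_codes by metis
  qed
qed

definition diagrams :: "(int^2 \<Rightarrow> nat) set" where
  "diagrams = {x. range x \<subseteq> codes \<and> (\<forall>b. valid (row x b) \<and> row x (b - 1) = tick (row x b))}"

lemma sft_diagrams: "sft codes diagrams"
proof -
  define Q where "Q = (\<lambda>x :: int^2 \<Rightarrow> nat. let u = row x 0; w = row x (- 1) in
    adj (u 0) (u 1) \<and>
    (is_head (u 0) \<longrightarrow> (w (- 1), w 0, w 1, w 2) = rule (u (- 1)) (u 0) (u 1) (u 2)) \<and>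
    (\<not> is_head (u (- 2)) \<and> \<not> is_head (u (- 1)) \<and> \<not> is_head (u 0) \<and> \<not> is_head (u 1) \<longrightarrow> w 0 = u 0))"
  define D where "D = (\<lambda>(a, b). vector [a, b] :: int^2) ` ({-2..2} \<times> {-1, 0})"
  have "sft codes {x. range x \<subseteq> codes \<and> (\<forall>k. Q (shift k x))}"
  proof (rule sft_of_local_condition[OF finite_codes])
    show "finite D"
      by (simp add: D_def)
    fix x y :: "int^2 \<Rightarrow> nat" assume eq: "\<And>m. m \<in> D \<Longrightarrow> x m = y m"
    have "row x b a = row y b a" if "a \<in> {-2..2}" "b \<in> {-1, 0}" for a b
      using eq[of "vector [a, b]"] that unfolding row_def D_def by (metis (mono_tags) SigmaI image_eqI old.prod.case)
    then show "Q x = Q y"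
      by (simp add: Q_def Let_def)
  qed
  moreover have "x \<in> diagrams \<longleftrightarrow> range x \<subseteq> codes \<and> (\<forall>k. Q (shift k x))" for x
  proof (cases "range x \<subseteq> codes")
    case True
    then have l: "letter (row x b a)" for a b
      by (auto simp: row_def intro: letter_from_nat)
    have Q: "Q (shift (vector [a, b]) x) \<longleftrightarrow> (let u = row x b; w = row x (b - 1) in
        adj (u a) (u (a + 1)) \<and>
        (is_head (u a) \<longrightarrow> (w (a - 1), w a, w (a + 1), w (a + 2)) =
          rule (u (a - 1)) (u a) (u (a + 1)) (u (a + 2))) \<and>
        (\<not> is_head (u (a - 2)) \<and> \<not> is_head (u (a - 1)) \<and> \<not> is_head (u a) \<and> \<not> is_head (u (a + 1)) \<longrightarrow>
          w a = u a))" for a b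
      by (simp add: Q_def Let_def row_shift)
    have "(\<forall>k. Q (shift k x)) \<longleftrightarrow> (\<forall>b a. Q (shift (vector [a, b]) x))"
      by (metis vector_2_eta)
    also have "\<dots> \<longleftrightarrow> (\<forall>b. valid (row x b) \<and> row x (b - 1) = tick (row x b))"
    proof (intro all_cong1)
      fix b
      have "valid (row x b) \<longleftrightarrow> (\<forall>a. adj (row x b a) (row x b (a + 1)))"
        using l by (simp add: valid_def)
      then show "(\<forall>a. Q (shift (vector [a, b]) x)) \<longleftrightarrow> valid (row x b) \<and> row x (b - 1) = tick (row x b)"
        using tick_iff_local[of "row x b" "row x (b - 1)"] unfolding Q Let_def by blast
    qed
    finally show ?thesis
      using True by (simp add: diagrams_def)
  qed (simp add: diagrams_def)
  then have "diagrams = {x. range x \<subseteq> codes \<and> (\<forall>k. Q (shift k x))}"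
    by blast
  ultimately show ?thesis
    by simp
qed

text \<open>Rows further south follow by \<open>tick\<close>, rows further north by its
  injectivity.\<close>

lemma diagrams_determined:
  assumes x: "x \<in> diagrams" and y: "y \<in> diagrams" and eq: "row x c = row y c"
  shows "x = y"
proof -
  have rows: "row x b = row y b" for b
  proof (induction b rule: int_induct[of _ c])
    case (step1 b)
    have "tick (row x (b + 1)) = tick (row y (b + 1))" "valid (row x (b + 1))" "valid (row y (b + 1))"
      using x y step1 unfolding diagrams_def by (metis (mono_tags, lifting) add_diff_cancel_right' mem_Collect_eq)+
    then show ?case
      using inj_onD[OF inj_tick] by blast
  next
    case (step2 b)
    then show ?case
      using x y by (simp add: diagrams_def)
  qed (fact eq)
  show ?thesis
  proof
    fix v :: "int^2"
    have "(from_nat (x v) :: cell) = from_nat (y v)"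
      using fun_cong[OF rows[of "v $ 2"], of "v $ 1"] by (simp add: row_def)
    moreover have "x v \<in> codes" "y v \<in> codes"
      using x y by (auto simp: diagrams_def)
    ultimately show "x v = y v"
      using to_from_codes by metis
  qed
qed

lemma countable_diagrams: "countable diagrams"
proof (rule countable_image_inj_on)
  show "countable ((\<lambda>x. row x 0) ` diagrams)"
    by (rule countable_subset[OF _ countable_valid]) (auto simp: diagrams_def)
  show "inj_on (\<lambda>x. row x 0) diagrams"
    by (rule inj_onI) (rule diagrams_determined)
qed

lemma deterministic_diagrams: "deterministic diagrams"
proof -
  have inv: "matrix_inv (mat 1 :: int^2^2) = mat 1"
    unfolding matrix_inv_def by (rule some_equality) (auto simp: matrix_mul_lid matrix_mul_rid)
  have "transform (mat 1) = (id :: (int^2 \<Rightarrow> nat) \<Rightarrow> _)"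
    by (auto simp: transform_def inv matrix_vector_mul_lid)
  moreover have "southward_deterministic diagrams"
    unfolding southward_deterministic_def
  proof (intro ballI impI)
    fix x y assume "x \<in> diagrams" "y \<in> diagrams" "\<forall>v\<in>upper_half_plane. x v = y v"
    moreover from this have "row x 1 = row y 1"
      by (auto simp: row_def upper_half_plane_def)
    ultimately show "x = y"
      by (blast intro: diagrams_determined)
  qed
  \<comment> \<open>The counterclockwise rotation of \<open>(0, -1)\<close> is
    \<open>(1, 0)\<close>, so the identity matrix serves.\<close>
  ultimately have "deterministic_in_direction (vector [0, - 1]) diagrams"
    unfolding deterministic_in_direction_def
    by (auto simp: matrix_vector_mul_lid intro!: exI[of _ "mat 1"])
  then show ?thesis
    unfolding deterministic_def by blast
qed

lemma bounded_signal_diagrams: "bounded_signal diagrams"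
  unfolding bounded_signal_def
proof (intro exI conjI)
  show "projective_subdynamics diagrams \<subseteq> valid_codes"
  proof
    fix y assume "y \<in> projective_subdynamics diagrams"
    then obtain x where "x \<in> diagrams" and y: "y = (\<lambda>j. x (vector [j, 0]))"
      by (auto simp: projective_subdynamics_def)
    then have "valid (row x 0)" "range x \<subseteq> codes"
      by (auto simp: diagrams_def)
    moreover have "row x 0 = from_nat \<circ> y"
      by (auto simp: row_def y)
    ultimately show "y \<in> valid_codes"
      by (auto simp: valid_codes_def y)
  qed
qed (fact sft_valid_codes countable_valid_codes)+

section \<open>The points of the programs and their patterns\<close>

definition point :: "nat \<Rightarrow> int^2 \<Rightarrow> nat" where
  "point q v = to_nat (orbit q (- (v $ 2)) (v $ 1))"

lemma row_point: "row (point q) b = orbit q (- b)"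
  by (auto simp: row_def point_def)

lemma point_diagrams: "q \<le> n \<Longrightarrow> point q \<in> diagrams"
  using valid_letter[OF valid_orbit]
  by (auto simp: diagrams_def row_point valid_orbit tick_orbit codes_def point_def)

lemma subpattern_point_if_lt:
  assumes "lt p q" "0 < p" "q \<le> n"
  shows "subpattern (point p) (point q)"
  unfolding subpattern_def
proof
  fix \<pi> assume "\<pi> \<in> patterns (point p)"
  then obtain k where fin: "finite (dom \<pi>)" and k: "\<And>m. m \<in> dom \<pi> \<Longrightarrow> \<pi> m = Some (point p (k + m))"
    by (auto simp: patterns_def occurs_def shift_def)
  define B where "B = (\<Sum>m\<in>dom \<pi>. nat \<bar>(k + m) $ 1\<bar> + nat \<bar>(k + m) $ 2\<bar>)"
  have "nat \<bar>(k + m) $ 1\<bar> + nat \<bar>(k + m) $ 2\<bar> \<le> B" if "m \<in> dom \<pi>" for m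
    unfolding B_def by (rule member_le_sum[OF that]) (use fin in auto)
  then have B: "\<bar>- (k + m) $ 2\<bar> \<le> int B" "\<bar>(k + m) $ 1\<bar> \<le> int B" if "m \<in> dom \<pi>" for m
    using that by fastforce+
  obtain s where s: "\<And>t j. \<bar>t\<bar> \<le> int B \<Longrightarrow> \<bar>j\<bar> \<le> int B \<Longrightarrow> orbit p t j = orbit q (s + t) j"
    using orbit_contains[OF assms, of B] by blast
  \<comment> \<open>A delay by \<open>s\<close> in time is a translation by \<open>s\<close> to the
    south.\<close>
  have "point q ((k + vector [0, - s]) + m) = point p (k + m)" if "m \<in> dom \<pi>" for m
    using s[OF B[OF that]] by (simp add: point_def algebra_simps)
  then have "occurs \<pi> (point q)"
    unfolding occurs_def shift_def using k by (metis (no_types, lifting))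
  then show "\<pi> \<in> patterns (point q)"
    using fin by (simp add: patterns_def)
qed

text \<open>The single letter \<open>Call p\<close> separates the points: it occurs in the point of
  \<open>p\<close> at time 0, and by \<open>below_orbit\<close> only in points of programs weakly
  above \<open>p\<close>.\<close>

lemma weakly_below_if_subpattern_point:
  assumes "subpattern (point p) (point q)" "q \<le> n"
  shows "weakly_below p q"
proof -
  have "occurs [0 \<mapsto> to_nat (Call p)] (point p)"
    unfolding occurs_def
    by (rule exI[of _ "vector [1, 0]"]) (simp add: shift_def point_def orbit_def sweep_def)
  then have "[0 \<mapsto> to_nat (Call p)] \<in> patterns (point p)"
    by (simp add: patterns_def)
  with assms(1) have "[0 \<mapsto> to_nat (Call p)] \<in> patterns (point q)"
    unfolding subpattern_def by blast
  then obtain k where "to_nat (Call p) = point q k"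
    by (auto simp: patterns_def occurs_def shift_def)
  then have "orbit q (- (k $ 2)) (k $ 1) = Call p"
    by (simp add: point_def)
  then show ?thesis
    using below_orbit[OF assms(2), of "- (k $ 2)" "k $ 1"] by simp
qed

lemma subpattern_point_iff:
  assumes "0 < p" "q \<le> n"
  shows "subpattern (point p) (point q) \<longleftrightarrow> p = q \<or> lt p q"
  using weakly_below_if_subpattern_point[of p q] subpattern_point_if_lt[of p q] assms
  by (auto simp: weakly_below_def subpattern_def)

end

section \<open>Numbering the poset and embedding it\<close>

lemma finite_partial_order_linear_extension:
  fixes P :: "'p set"
  assumes "finite P" and po: "partial_order_on P r"
  shows "\<exists>g :: 'p \<Rightarrow> nat. inj_on g P \<and> (\<forall>p q. (p, q) \<in> r \<longrightarrow> p \<noteq> q \<longrightarrow> g p < g q)"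
proof -
  have sub: "r \<subseteq> P \<times> P" and r: "refl_on P r" "trans r" "antisym r"
    using po by (auto simp: partial_order_on_def preorder_on_def)
  obtain e :: "'p \<Rightarrow> nat" and M where e: "e ` P = {i. i < M}" "inj_on e P"
    using finite_imp_inj_to_nat_seg[OF assms(1)] by metis
  define d where "d q = card {p. (p, q) \<in> r}" for q
  \<comment> \<open>The size of the lower set grows strictly along the order; the injective
    numbering \<open>e\<close>, bounded by \<open>M\<close>, breaks ties.\<close>
  define g where "g p = d p * M + e p" for p
  have lt: "e p < M" if "p \<in> P" for p
    using e(1) that by blast
  have "inj_on g P"
  proof (rule inj_onI)
    fix p q assume pq: "p \<in> P" "q \<in> P" "g p = g q"
    then have "e p = e q"
      using lt[of p] lt[of q] unfolding g_def by (metis mod_less mod_mult_self3)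
    then show "p = q"
      using e(2) pq by (auto dest: inj_onD)
  qed
  moreover have "g p < g q" if pq: "(p, q) \<in> r" "p \<noteq> q" for p q
  proof -
    have P: "p \<in> P" "q \<in> P"
      using pq sub by auto
    have "(q, q) \<in> r" "(q, p) \<notin> r"
      using P pq r by (auto dest: refl_onD antisymD)
    then have "{x. (x, p) \<in> r} \<subset> {x. (x, q) \<in> r}"
      using pq r(2) by (auto dest: transD)
    moreover have "finite {x. (x, q) \<in> r}"
      by (rule finite_subset[OF _ assms(1)]) (use sub in auto)
    ultimately have "Suc (d p) \<le> d q"
      unfolding d_def by (metis psubset_card_mono Suc_leI)
    then have "Suc (d p) * M \<le> d q * M"
      by (rule mult_le_mono1)
    then show ?thesis
      using lt[OF P(1)] by (simp add: g_def)
  qed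
  ultimately show ?thesis
    by blast
qed

theorem theorem6p1:
  fixes P :: "'p set" and r :: "'p rel"
  assumes "finite P" and "partial_order_on P r"
  shows "\<exists>(S :: nat set) (X :: (int^2 \<Rightarrow> nat) set).
           sft S X \<and> countable X \<and> deterministic X \<and> bounded_signal X \<and>
           (\<exists>\<phi>. order_embedding P r (SP X) (SP_le X) \<phi>)"
proof -
  have r: "refl_on P r" "trans r" "antisym r"
    using assms(2) by (auto simp: partial_order_on_def preorder_on_def)
  obtain g0 :: "'p \<Rightarrow> nat" where g0: "inj_on g0 P" "\<And>p q. (p, q) \<in> r \<Longrightarrow> p \<noteq> q \<Longrightarrow> g0 p < g0 q"
    using finite_partial_order_linear_extension[OF assms] by blast
  \<comment> \<open>The successor reserves 0 for the trivial program.\<close>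
  define g where "g = Suc \<circ> g0"
  have inj: "inj_on g P"
    unfolding g_def using g0(1) by (simp add: comp_inj_on)
  have less: "g p < g q" if "(p, q) \<in> r" "p \<noteq> q" for p q
    using g0(2)[OF that] by (simp add: g_def)
  \<comment> \<open>Inserting 0 covers the empty poset.\<close>
  define n where "n = Max (insert 0 (g ` P))"
  have g: "0 < g p" "g p \<le> n" if "p \<in> P" for p
    using that assms(1) by (auto simp: g_def n_def intro!: Max_ge)
  define lt where "lt a b \<longleftrightarrow> (\<exists>p\<in>P. \<exists>q\<in>P. g p = a \<and> g q = b \<and> (p, q) \<in> r \<and> p \<noteq> q)" for a b
  have lt_g: "lt (g p) (g q) \<longleftrightarrow> (p, q) \<in> r \<and> p \<noteq> q" if "p \<in> P" "q \<in> P" for p q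
    using that inj by (auto simp: lt_def dest: inj_onD)
  interpret machine n lt
  proof
    fix a b c assume "lt a b" "lt b c"
    then obtain p q q' s where *: "p \<in> P" "q \<in> P" "g p = a" "g q = b" "(p, q) \<in> r" "p \<noteq> q"
      "q' \<in> P" "s \<in> P" "g q' = b" "g s = c" "(q', s) \<in> r" "q' \<noteq> s"
      unfolding lt_def by blast
    have "q' = q"
      using inj_onD[OF inj, of q' q] * by simp
    have "(p, s) \<in> r"
      using *(5,11) \<open>q' = q\<close> r(2) by (blast dest: transD)
    moreover have "p \<noteq> s"
      using *(5,6,11) \<open>q' = q\<close> r(3) by (blast dest: antisymD)
    ultimately show "lt a c"
      using *(1,3,8,10) unfolding lt_def by blast
  qed (auto simp: lt_def less)
  have sub: "subpattern (point (g p)) (point (g q)) \<longleftrightarrow> (p, q) \<in> r" if "p \<in> P" "q \<in> P" for p q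
  proof -
    have "subpattern (point (g p)) (point (g q)) \<longleftrightarrow> p = q \<or> (p, q) \<in> r \<and> p \<noteq> q"
      unfolding subpattern_point_iff[OF g(1)[OF that(1)] g(2)[OF that(2)]] lt_g[OF that]
      using inj_on_eq_iff[OF inj that] by simp
    then show ?thesis
      using refl_onD[OF r(1) that(1)] by blast
  qed
  define E where "E = {(x, y). x \<in> diagrams \<and> y \<in> diagrams \<and> subpattern x y \<and> subpattern y x}"
  define \<phi> where "\<phi> p = E `` {point (g p)}" for p
  have diagrams: "point (g p) \<in> diagrams" if "p \<in> P" for p
    using point_diagrams g(2)[OF that] by blast
  have SP: "\<phi> p \<in> SP diagrams" if "p \<in> P" for p
    using diagrams[OF that] unfolding SP_def \<phi>_def E_def by (rule quotientI)
  have mem: "point (g p) \<in> \<phi> p" if "p \<in> P" for p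
    using diagrams[OF that] by (simp add: \<phi>_def E_def subpattern_def)
  have iff: "(\<phi> p, \<phi> q) \<in> SP_le diagrams \<longleftrightarrow> (p, q) \<in> r" if "p \<in> P" "q \<in> P" for p q
    using SP_le_iff[OF SP[OF that(1)] SP[OF that(2)] mem[OF that(1)] mem[OF that(2)]]
      sub[OF that] by simp
  have "inj_on \<phi> P"
  proof (rule inj_onI)
    fix p q assume pq: "p \<in> P" "q \<in> P" "\<phi> p = \<phi> q"
    then have "(p, q) \<in> r" "(q, p) \<in> r"
      using iff[of p q] iff[of q p] iff[of p p] refl_onD[OF r(1), of p] by simp_all
    then show "p = q"
      by (rule antisymD[OF r(3)])
  qed
  then have "order_embedding P r (SP diagrams) (SP_le diagrams) \<phi>"
    using SP iff by (auto simp: order_embedding_def)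
  then show ?thesis
    using sft_diagrams countable_diagrams deterministic_diagrams bounded_signal_diagrams by blast
qed

end
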